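(* Let $(X,\|\cdot\|)$ be a Banach space and let $G$ be a subgroup of $\mathrm{Aut}(X)$. Let $R\subseteq B(X^* )$ be $G$-stable, and let $W\subset X$ be $G$-stable and weakly compact. If the pseudo metric space $(W,d_R/G)$ is totally bounded, then $(W,d_R/G)$ is compact.
   Context: $X^*$ is the dual space of $X$ and $B(Y)=\{y\in Y:\|y\|\le 1\}$ denotes the closed unit ball of a normed space $Y$. $\mathrm{Aut}(X)$ is the group of invertible maps $g:X\to X$ preserving the metric $d(x,y)=\|x-y\|$. A group $G$ acting on a set $S$ acts on functions $f$ on $S$ by $(gf)(s)=f(g^{-1}s)$; a subset $T$ is $G$-stable if $GT=\{gt:g\in G,t\in T\}=T$. For a bounded $R\subseteq X^*$ define the seminorm $\|x\|_R:=\sup_{r\in R}|r(x)|$ and pseudo metric $d_R(x,y):=\|x-y\|_R$, and $(d_R/G)(x,y):=\inf_{g\in G} d_R(x,gy)$. "Weakly compact" refers to the weak topology on $X$ induced by $X^*$. A pseudo metric space is totally bounded if for each $\varepsilon>0$ it is covered by finitely many balls of radius $\varepsilon$. *)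

theory Defs
  imports "HOL-Analysis.Analysis" "HOL-Algebra.Group"
begin

(* A Banach space over the real or the complex numbers: a real Banach space 'a with a scalar
   multiplication by 'k that extends the real one and for which the norm is homogeneous.
   By the Gelfand-Mazur theorem, the reals and the complex numbers are, up to isomorphism,
   the only instances of real_normed_field. *)
locale banach_space_over = vector_space smul
  for smul :: "'k::real_normed_field \<Rightarrow> 'a::banach \<Rightarrow> 'a" +
  assumes smul_of_real: "smul (of_real t) x = t *\<^sub>R x"
    and norm_smul: "norm (smul c x) = norm c * norm x"

lemma banach_space_over_real:
  "banach_space_over (scaleR :: real \<Rightarrow> 'a::banach \<Rightarrow> 'a)"
  by unfold_locales (auto simp: algebra_simps)

lemma banach_space_over_complex:
  "banach_space_over ((*) :: complex \<Rightarrow> complex \<Rightarrow> complex)"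
  by unfold_locales (auto simp: algebra_simps scaleR_conv_of_real norm_mult)

definition dual_space :: "('k::real_normed_field \<Rightarrow> 'a::banach \<Rightarrow> 'a) \<Rightarrow> ('a \<Rightarrow> 'k) set" where
  "dual_space smul = {f. bounded_linear f \<and> (\<forall>c x. f (smul c x) = c * f x)}"

definition dual_unit_ball ::
  "('k::real_normed_field \<Rightarrow> 'a::banach \<Rightarrow> 'a) \<Rightarrow> ('a \<Rightarrow> 'k) set" where
  "dual_unit_ball smul = {f \<in> dual_space smul. onorm f \<le> 1}"

definition weak_topology ::
  "('k::real_normed_field \<Rightarrow> 'a::banach \<Rightarrow> 'a) \<Rightarrow> 'a topology" where
  "weak_topology smul = topology_generated_by {f -` U | f U. f \<in> dual_space smul \<and> open U}"

lemma topspace_weak_topology: "topspace (weak_topology smul) = UNIV"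
proof -
  have "(\<lambda>_. 0) \<in> dual_space smul"
    by (simp add: dual_space_def)
  then have "UNIV \<in> {f -` U | f U. f \<in> dual_space smul \<and> open U}"
    by force
  then show ?thesis
    unfolding weak_topology_def topology_generated_by_topspace by blast
qed

(* The isometries are not required to be linear. *)
definition Aut :: "('a::metric_space \<Rightarrow> 'a) monoid" where
  "Aut = \<lparr>carrier = {g. bij g \<and> (\<forall>x y. dist (g x) (g y) = dist x y)},
          mult = (\<circ>), one = id\<rparr>"

lemma group_Aut: "group (Aut :: ('a::metric_space \<Rightarrow> 'a) monoid)"
proof (rule groupI)
  fix g :: "'a \<Rightarrow> 'a"
  assume "g \<in> carrier Aut"
  then have b: "bij g" and d: "\<And>x y. dist (g x) (g y) = dist x y"
    by (auto simp: Aut_def)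
  have "dist (inv_into UNIV g x) (inv_into UNIV g y) = dist x y" for x y
    by (metis b bij_inv_eq_iff d)
  then show "\<exists>h \<in> carrier Aut. h \<otimes>\<^bsub>Aut\<^esub> g = \<one>\<^bsub>Aut\<^esub>"
    using b by (intro bexI[of _ "inv_into UNIV g"])
      (auto simp: Aut_def bij_imp_bij_inv bij_is_inj)
qed (auto simp: Aut_def bij_comp comp_assoc)

(* The induced action (g f)(s) = f (g^-1 s) on functions.  The inverse is written with inv_into
   because the notation inv is overloaded by HOL-Algebra. *)
definition fun_action :: "('a \<Rightarrow> 'a) \<Rightarrow> ('a \<Rightarrow> 'b) \<Rightarrow> ('a \<Rightarrow> 'b)" where
  "fun_action g f = (\<lambda>s. f (inv_into UNIV g s))"

definition action_stable :: "('g \<Rightarrow> 's \<Rightarrow> 's) \<Rightarrow> 'g set \<Rightarrow> 's set \<Rightarrow> bool" where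
  "action_stable act G T \<longleftrightarrow> {act g t | g t. g \<in> G \<and> t \<in> T} = T"

(* Inserting 0 only matters for empty R, where Sup is unspecified on the reals
   and the seminorm should be 0. *)
definition seminorm_of :: "('a \<Rightarrow> 'k::real_normed_field) set \<Rightarrow> 'a \<Rightarrow> real" where
  "seminorm_of R x = Sup (insert 0 ((\<lambda>r. norm (r x)) ` R))"

definition dist_of :: "('a::ab_group_add \<Rightarrow> 'k::real_normed_field) set \<Rightarrow> 'a \<Rightarrow> 'a \<Rightarrow> real" where
  "dist_of R x y = seminorm_of R (x - y)"

definition orbit_dist :: "('a \<Rightarrow> 'a \<Rightarrow> real) \<Rightarrow> ('a \<Rightarrow> 'a) set \<Rightarrow> 'a \<Rightarrow> 'a \<Rightarrow> real" where
  "orbit_dist d G x y = (INF g\<in>G. d x (g y))"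

(* Pseudo metric spaces (M, d).  The locale Metric_space of HOL-Analysis is not applicable,
   since distinct points may have distance 0. *)
definition pm_ball :: "'a set \<Rightarrow> ('a \<Rightarrow> 'a \<Rightarrow> real) \<Rightarrow> 'a \<Rightarrow> real \<Rightarrow> 'a set" where
  "pm_ball M d x e = {y \<in> M. d x y < e}"

definition pm_totally_bounded :: "'a set \<Rightarrow> ('a \<Rightarrow> 'a \<Rightarrow> real) \<Rightarrow> bool" where
  "pm_totally_bounded M d \<longleftrightarrow>
     (\<forall>e>0. \<exists>F. finite F \<and> F \<subseteq> M \<and> M \<subseteq> (\<Union>x\<in>F. pm_ball M d x e))"

definition pm_topology :: "'a set \<Rightarrow> ('a \<Rightarrow> 'a \<Rightarrow> real) \<Rightarrow> 'a topology" where
  "pm_topology M d = topology (\<lambda>U. U \<subseteq> M \<and> (\<forall>x\<in>U. \<exists>e>0. pm_ball M d x e \<subseteq> U))"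

lemma openin_pm_topology:
  "openin (pm_topology M d) U \<longleftrightarrow> U \<subseteq> M \<and> (\<forall>x\<in>U. \<exists>e>0. pm_ball M d x e \<subseteq> U)"
proof -
  have "istopology (\<lambda>U. U \<subseteq> M \<and> (\<forall>x\<in>U. \<exists>e>0. pm_ball M d x e \<subseteq> U))"
    unfolding istopology_def
  proof (intro conjI allI impI ballI)
    fix S T x
    assume S: "S \<subseteq> M \<and> (\<forall>x\<in>S. \<exists>e>0. pm_ball M d x e \<subseteq> S)"
      and T: "T \<subseteq> M \<and> (\<forall>x\<in>T. \<exists>e>0. pm_ball M d x e \<subseteq> T)" and x: "x \<in> S \<inter> T"
    obtain a b where "a > 0" "pm_ball M d x a \<subseteq> S" "b > 0" "pm_ball M d x b \<subseteq> T"
      using S T x by blast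
    then show "\<exists>e>0. pm_ball M d x e \<subseteq> S \<inter> T"
      by (intro exI[of _ "min a b"]) (auto simp: pm_ball_def)
  next
    fix K
    assume K: "\<forall>S\<in>K. S \<subseteq> M \<and> (\<forall>x\<in>S. \<exists>e>0. pm_ball M d x e \<subseteq> S)"
    then show "\<Union>K \<subseteq> M"
      by blast
    fix x
    assume "x \<in> \<Union>K"
    then obtain S where "S \<in> K" "x \<in> S"
      by blast
    with K obtain e where "e > 0" "pm_ball M d x e \<subseteq> S"
      by metis
    with \<open>S \<in> K\<close> show "\<exists>e>0. pm_ball M d x e \<subseteq> \<Union>K"
      by blast
  qed blast
  then show ?thesis
    by (simp add: pm_topology_def topology_inverse')
qed

lemma topspace_pm_topology: "topspace (pm_topology M d) = M"
proof -
  have "openin (pm_topology M d) M"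
    unfolding openin_pm_topology
    by (intro conjI ballI exI[of _ 1]) (simp_all add: pm_ball_def)
  then show ?thesis
    by (metis openin_pm_topology openin_subset openin_topspace subset_antisym)
qed

end

theory Submission imports Defs begin

text \<open>
  A totally bounded and complete pseudo metric space is compact, so only completeness of
  \<open>d\<^sub>R/G\<close> on \<open>W\<close> is at stake.  Since \<open>R\<close> is \<open>G\<close>-stable, \<open>G\<close> acts by
  \<open>d\<^sub>R\<close>-isometries; hence a fast Cauchy sequence for \<open>d\<^sub>R/G\<close> can be moved along its orbits to
  a fast Cauchy sequence \<open>y\<close> for \<open>d\<^sub>R\<close>.  The \<open>d\<^sub>R\<close>-balls around the \<open>y n\<close> are weakly closed,
  being intersections of conditions on single functionals \<open>r \<in> R\<close>, so weak compactness of \<open>W\<close>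
  yields a common point of all of them, which is a \<open>d\<^sub>R\<close>-limit of \<open>y\<close>.
\<close>

section \<open>Compactness of totally bounded, complete pseudo metric spaces\<close>

lemma compact_space_pm_topology:
  fixes d :: "'a \<Rightarrow> 'a \<Rightarrow> real"
  assumes sym: "\<And>x y. x \<in> M \<Longrightarrow> y \<in> M \<Longrightarrow> d x y = d y x"
    and tri: "\<And>x y z. x \<in> M \<Longrightarrow> y \<in> M \<Longrightarrow> z \<in> M \<Longrightarrow> d x z \<le> d x y + d y z"
    and tb: "pm_totally_bounded M d"
    and complete: "\<And>x. (\<And>n. x n \<in> M) \<Longrightarrow> (\<And>n. d (x n) (x (Suc n)) < (1/2) ^ n)
      \<Longrightarrow> \<exists>l\<in>M. \<forall>n. d l (x n) \<le> 2 * (1/2) ^ n"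
  shows "compact_space (pm_topology M d)"
  unfolding compact_space_alt topspace_pm_topology
proof (intro allI impI, elim conjE)
  fix \<U>
  assume op: "\<forall>U\<in>\<U>. openin (pm_topology M d) U" and cov: "M \<subseteq> \<Union>\<U>"
  define small where "small S \<longleftrightarrow> (\<exists>\<F>. finite \<F> \<and> \<F> \<subseteq> \<U> \<and> S \<subseteq> \<Union>\<F>)" for S
  have small_Union: "small (\<Union>i\<in>F. A i)"
    if "finite F" "\<And>i. i \<in> F \<Longrightarrow> small (A i)" for F and A :: "'a \<Rightarrow> 'a set"
    using that
  proof (induction F rule: finite_induct)
    case empty
    then show ?case by (auto simp: small_def)
  next
    case (insert i F)
    obtain \<F> where f: "finite \<F>" "\<F> \<subseteq> \<U>" "A i \<subseteq> \<Union>\<F>"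
      using insert.prems[of i] by (auto simp: small_def)
    obtain \<G> where g: "finite \<G>" "\<G> \<subseteq> \<U>" "(\<Union>i\<in>F. A i) \<subseteq> \<Union>\<G>"
      using insert.IH insert.prems by (auto simp: small_def)
    show ?case
      unfolding small_def using f g by (intro exI[of _ "\<F> \<union> \<G>"]) auto
  qed
  have "small M"
  proof (rule ccontr)
    assume "\<not> small M"
    \<comment> \<open>Finitely many balls cut \<open>S\<close> into pieces, and a finite union of
      small pieces is small, so some piece is not. Halving the radius each time makes the chosen
      pieces shrink geometrically.\<close>
    have step: "\<exists>T. (T \<subseteq> M \<and> \<not> small T) \<and> T \<subseteq> S \<and> (\<exists>x\<in>M. T \<subseteq> pm_ball M d x ((1/2) ^ Suc n))"
      if S: "S \<subseteq> M \<and> \<not> small S" for S n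
    proof -
      obtain F where F: "finite F" "F \<subseteq> M" "M \<subseteq> (\<Union>x\<in>F. pm_ball M d x ((1/2) ^ Suc n))"
        using tb unfolding pm_totally_bounded_def by (meson zero_less_divide_1_iff zero_less_numeral zero_less_power)
      have "S = (\<Union>x\<in>F. S \<inter> pm_ball M d x ((1/2) ^ Suc n))"
        using S F(3) by blast
      then obtain x where "x \<in> F" "\<not> small (S \<inter> pm_ball M d x ((1/2) ^ Suc n))"
        using small_Union[OF F(1)] S by metis
      then show ?thesis
        using S F(2) by (intro exI[of _ "S \<inter> pm_ball M d x ((1/2) ^ Suc n)"]) blast
    qed
    have "\<exists>S. \<forall>n. (S n \<subseteq> M \<and> \<not> small (S n)) \<and>
        (S (Suc n) \<subseteq> S n \<and> (\<exists>x\<in>M. S (Suc n) \<subseteq> pm_ball M d x ((1/2) ^ Suc n)))"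
      by (rule dependent_nat_choice[OF _ step]) (use \<open>\<not> small M\<close> in blast)
    then obtain S where S: "\<And>n. S n \<subseteq> M \<and> \<not> small (S n)"
      and S_Suc: "\<And>n. S (Suc n) \<subseteq> S n \<and> (\<exists>x\<in>M. S (Suc n) \<subseteq> pm_ball M d x ((1/2) ^ Suc n))"
      by metis
    \<comment> \<open>Both points lie in one ball of radius \<open>(1/2) ^ Suc n\<close>, and
      passing through its centre doubles the radius. \<open>S 0\<close> lies in no chosen ball,
      hence the shift to \<open>Suc n\<close>.\<close>
    have close: "d y z < (1/2) ^ n" if "y \<in> S (Suc n)" "z \<in> S (Suc n)" for y z n
    proof -
      obtain x where x: "x \<in> M" "S (Suc n) \<subseteq> pm_ball M d x ((1/2) ^ Suc n)"
        using S_Suc by blast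
      then have "d x y < (1/2) ^ Suc n" "d x z < (1/2) ^ Suc n" "y \<in> M" "z \<in> M"
        using that S by (auto simp: pm_ball_def)
      then show ?thesis
        using tri[of y x z] sym[of x y] x(1) by simp
    qed
    \<comment> \<open>The empty set is small, being covered by the empty subfamily.\<close>
    have "\<exists>p. p \<in> S (Suc n)" for n
      using S[of "Suc n"] by (fastforce simp: small_def)
    then obtain p where p: "\<And>n. p n \<in> S (Suc n)"
      by metis
    have pM: "p n \<in> M" for n
      using p S by blast
    have "d (p n) (p (Suc n)) < (1/2) ^ n" for n
      using close p S_Suc by blast
    then obtain l where l: "l \<in> M" "\<And>n. d l (p n) \<le> 2 * (1/2) ^ n"
      using complete pM by blast
    obtain U where U: "U \<in> \<U>" "l \<in> U"
      using cov l by blast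
    then obtain e where e: "e > 0" "pm_ball M d l e \<subseteq> U"
      using op unfolding openin_pm_topology by meson
    \<comment> \<open>From \<open>l\<close> to \<open>p n\<close> costs at most
      \<open>2 * (1/2) ^ n\<close>, and from \<open>p n\<close> to any point of
      \<open>S (Suc n)\<close> less than \<open>(1/2) ^ n\<close>: three units in all.\<close>
    obtain n where n: "(1/2) ^ n < e / 3"
      using real_arch_pow_inv[of "e/3" "1/2"] e by auto
    have "S (Suc n) \<subseteq> U"
    proof
      fix z
      assume z: "z \<in> S (Suc n)"
      then have "z \<in> M" "d (p n) z < (1/2) ^ n"
        using S close p by blast+
      then have "z \<in> pm_ball M d l e"
        using tri[of l "p n" z] l(1) l(2)[of n] pM[of n] n by (simp add: pm_ball_def)
      then show "z \<in> U"
        using e by blast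
    qed
    then have "small (S (Suc n))"
      unfolding small_def using U by (intro exI[of _ "{U}"]) simp
    then show False
      using S by blast
  qed
  then show "\<exists>\<F>. finite \<F> \<and> \<F> \<subseteq> \<U> \<and> M \<subseteq> \<Union>\<F>"
    by (simp add: small_def)
qed

section \<open>Distances between orbits under a group of isometries\<close>

lemma subgroup_Aut_id: "subgroup G Aut \<Longrightarrow> id \<in> G"
  using subgroup.one_closed by (fastforce simp: Aut_def)

lemma subgroup_Aut_comp: "subgroup G Aut \<Longrightarrow> g \<in> G \<Longrightarrow> h \<in> G \<Longrightarrow> g \<circ> h \<in> G"
  using subgroup.m_closed by (fastforce simp: Aut_def)

lemma subgroup_Aut_inverse:
  assumes G: "subgroup G Aut" and g: "g \<in> G"
  obtains h where "h \<in> G" "h \<circ> g = id" "g \<circ> h = id"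
proof
  have c: "g \<in> carrier Aut"
    using G g by (meson subgroup.mem_carrier)
  show "m_inv Aut g \<in> G"
    using subgroup.m_inv_closed[OF G g] .
  show "m_inv Aut g \<circ> g = id" "g \<circ> m_inv Aut g = id"
    using group.l_inv[OF group_Aut c] group.r_inv[OF group_Aut c] by (simp_all add: Aut_def)
qed

locale orbit_pseudo_metric =
  fixes G :: "('a::metric_space \<Rightarrow> 'a) set" and d :: "'a \<Rightarrow> 'a \<Rightarrow> real"
  assumes subgroup: "subgroup G Aut"
    and nonneg: "0 \<le> d x y"
    and commute: "d x y = d y x"
    and triangle: "d x z \<le> d x y + d y z"
    and invariant: "g \<in> G \<Longrightarrow> d (g x) (g y) = d x y"
begin

lemma orbit_dist_le: "g \<in> G \<Longrightarrow> orbit_dist d G x y \<le> d x (g y)"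
  unfolding orbit_dist_def by (rule cINF_lower) (auto intro!: bdd_belowI[of _ 0] simp: nonneg)

lemma orbit_dist_greatest: "(\<And>g. g \<in> G \<Longrightarrow> c \<le> d x (g y)) \<Longrightarrow> c \<le> orbit_dist d G x y"
  unfolding orbit_dist_def using subgroup_Aut_id[OF subgroup] by (intro cINF_greatest) auto

lemma orbit_dist_lessD: "orbit_dist d G x y < c \<Longrightarrow> \<exists>g\<in>G. d x (g y) < c"
  using orbit_dist_greatest[of c x y] by force

lemma orbit_dist_commute: "orbit_dist d G x y = orbit_dist d G y x"
proof -
  have "orbit_dist d G x y \<le> orbit_dist d G y x" for x y
  proof (rule orbit_dist_greatest)
    fix g
    assume g: "g \<in> G"
    obtain h where h: "h \<in> G" "h \<circ> g = id"
      using subgroup_Aut_inverse[OF subgroup g] by metis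
    \<comment> \<open>Invariance moves the group element to the other argument as its inverse, so
      both infima run over the same values.\<close>
    have "d x (h y) = d (h (g x)) (h y)"
      using h(2) by (metis comp_apply id_apply)
    also have "\<dots> = d y (g x)"
      using invariant[OF h(1)] commute by simp
    finally show "orbit_dist d G x y \<le> d y (g x)"
      using orbit_dist_le[OF h(1), of x y] by simp
  qed
  then show ?thesis
    by (simp add: antisym)
qed

lemma orbit_dist_triangle: "orbit_dist d G x z \<le> orbit_dist d G x y + orbit_dist d G y z"
proof -
  \<comment> \<open>Go from \<open>x\<close> to \<open>g y\<close> and on to \<open>g (h z)\<close>;
    by invariance the second leg has length \<open>d y (h z)\<close>. The infimum over
    \<open>h\<close> and then over \<open>g\<close> gives the claim.\<close>
  have "orbit_dist d G x z \<le> d x (g y) + d y (h z)" if "g \<in> G" "h \<in> G" for g h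
  proof -
    have "orbit_dist d G x z \<le> d x ((g \<circ> h) z)"
      using subgroup_Aut_comp[OF subgroup that] by (rule orbit_dist_le)
    also have "\<dots> \<le> d x (g y) + d (g y) (g (h z))"
      using triangle by simp
    finally show ?thesis
      using invariant that by simp
  qed
  then have "orbit_dist d G x z - d x (g y) \<le> orbit_dist d G y z" if "g \<in> G" for g
    using that by (intro orbit_dist_greatest) (simp add: algebra_simps)
  then have "orbit_dist d G x z - orbit_dist d G y z \<le> orbit_dist d G x y"
    by (intro orbit_dist_greatest) (simp add: algebra_simps)
  then show ?thesis by simp
qed

lemma orbit_dist_sequence_lift:
  assumes "\<And>n. orbit_dist d G (x n) (x (Suc n)) < e n"
  obtains h where "\<And>n. h n \<in> G" "\<And>n. d (h n (x n)) (h (Suc n) (x (Suc n))) < e n"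
proof -
  have "\<exists>g\<in>G. d (x n) (g (x (Suc n))) < e n" for n
    using assms orbit_dist_lessD by blast
  then obtain g where g: "\<And>n. g n \<in> G" "\<And>n. d (x n) (g n (x (Suc n))) < e n"
    by metis
  \<comment> \<open>\<open>h n\<close> is the product of \<open>g 0\<close> up to
    \<open>g (n - 1)\<close>, so \<open>h (Suc n)\<close> maps \<open>x (Suc n)\<close> to
    \<open>h n (g n (x (Suc n)))\<close>. The isometry \<open>h n\<close> thus carries the n-th
    estimate over to the lifted sequence.\<close>
  define h where "h = rec_nat id (\<lambda>n f. f \<circ> g n)"
  have h_simps: "h 0 = id" "h (Suc n) = h n \<circ> g n" for n
    by (simp_all add: h_def)
  have hG: "h n \<in> G" for n
    by (induction n)
      (simp_all only: h_simps subgroup_Aut_id[OF subgroup] subgroup_Aut_comp[OF subgroup] g(1))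
  show thesis
    by (rule that[of h, OF hG]) (simp add: h_simps(2) invariant[OF hG] g(2))
qed

end

section \<open>Limits from weak compactness\<close>

lemma weakly_compact_Cauchy_limit:
  fixes smul :: "'k::real_normed_field \<Rightarrow> 'a::banach \<Rightarrow> 'a" and y :: "nat \<Rightarrow> 'a"
  assumes R: "R \<subseteq> dual_space smul"
    and W: "compactin (weak_topology smul) W"
    and y: "\<And>n. y n \<in> W"
    and close: "\<And>m n r. n \<le> m \<Longrightarrow> r \<in> R \<Longrightarrow> norm (r (y m) - r (y n)) \<le> e n"
  obtains l where "l \<in> W" "\<And>n r. r \<in> R \<Longrightarrow> norm (r l - r (y n)) \<le> e n"
proof -
  define C :: "('a \<Rightarrow> 'k) \<Rightarrow> nat \<Rightarrow> 'a set" where "C r n = {w. norm (r w - r (y n)) \<le> e n}" for r n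
  have closed: "closedin (weak_topology smul) (C r n)" if "r \<in> R" for r n
  proof -
    \<comment> \<open>The complement of \<open>C r n\<close> is a subbasic weakly open set. This is
      why the constraints are split by functional.\<close>
    have "openin (weak_topology smul) (r -` (- cball (r (y n)) (e n)))"
      unfolding weak_topology_def
      using R that by (intro topology_generated_by_Basis) (auto simp: open_Compl)
    moreover have "UNIV - C r n = r -` (- cball (r (y n)) (e n))"
      by (auto simp: C_def dist_norm norm_minus_commute)
    ultimately show ?thesis
      by (simp add: closedin_def topspace_weak_topology)
  qed
  let ?\<C> = "case_prod C ` (R \<times> UNIV)"
  have fip: "W \<inter> \<Inter>\<F> \<noteq> {}" if "finite \<F>" "\<F> \<subseteq> ?\<C>" for \<F>
  proof -
    obtain I where I: "finite I" "I \<subseteq> R \<times> UNIV" "\<F> = case_prod C ` I"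
      using finite_subset_image[OF \<open>finite \<F>\<close> \<open>\<F> \<subseteq> ?\<C>\<close>] by blast
    obtain m where m: "\<forall>n\<in>snd ` I. n \<le> m"
      using finite_nat_set_iff_bounded_le I(1) by (metis finite_imageI)
    \<comment> \<open>Finitely many constraints mention only finitely many indices, and any term of
      \<open>y\<close> at or beyond them all satisfies each by \<open>close\<close>.\<close>
    have "y m \<in> \<Inter>\<F>"
      using I m close by (fastforce simp: C_def)
    then show ?thesis
      using y by blast
  qed
  have "W \<inter> \<Inter>?\<C> \<noteq> {}"
  proof -
    have "\<forall>K\<in>?\<C>. closedin (weak_topology smul) K"
      using closed by auto
    then show ?thesis
      using conjunct2[OF W[unfolded compactin_fip], rule_format, of ?\<C>] fip by simp
  qed
  then obtain l where "l \<in> W" "\<forall>r\<in>R. \<forall>n. l \<in> C r n"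
    by auto
  then show thesis
    by (intro that) (auto simp: C_def)
qed

section \<open>The pseudo metric \<open>dist_of R\<close> and its invariance\<close>

context
  fixes smul :: "'k::real_normed_field \<Rightarrow> 'a::banach \<Rightarrow> 'a" and R :: "('a \<Rightarrow> 'k) set"
  assumes R: "R \<subseteq> dual_unit_ball smul"
begin

lemma bounded_linear_R: "r \<in> R \<Longrightarrow> bounded_linear r"
  using R by (auto simp: dual_unit_ball_def dual_space_def)

lemma diff_R: "r \<in> R \<Longrightarrow> r (x - y) = r x - r y"
  by (simp add: bounded_linear.linear bounded_linear_R linear_diff)

lemma norm_R_le: "r \<in> R \<Longrightarrow> norm (r x) \<le> norm x"
proof -
  assume r: "r \<in> R"
  have "norm (r x) \<le> onorm r * norm x"
    using bounded_linear_R[OF r] by (rule onorm)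
  also have "\<dots> \<le> 1 * norm x"
    using R r by (intro mult_right_mono) (auto simp: dual_unit_ball_def)
  finally show ?thesis by simp
qed

text \<open>The unit ball bound on \<open>R\<close> makes \<open>norm x\<close> an upper bound, so
  that \<open>Sup\<close> is a genuine supremum.\<close>

lemma bdd_above_R: "bdd_above (insert 0 ((\<lambda>r. norm (r x)) ` R))"
  by (rule bdd_aboveI[of _ "norm x"]) (auto simp: norm_R_le)

lemma dist_of_nonneg: "0 \<le> dist_of R x y"
  unfolding dist_of_def seminorm_of_def by (rule cSup_upper[OF _ bdd_above_R]) simp

lemma norm_R_le_dist_of: "r \<in> R \<Longrightarrow> norm (r x - r y) \<le> dist_of R x y"
  unfolding dist_of_def seminorm_of_def diff_R[symmetric]
  by (rule cSup_upper[OF _ bdd_above_R]) simp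

text \<open>The condition \<open>0 \<le> c\<close> accounts for the 0 inserted in the supremum; for
  empty \<open>R\<close> it is the only constraint on \<open>c\<close>.\<close>

lemma dist_of_le: "0 \<le> c \<Longrightarrow> (\<And>r. r \<in> R \<Longrightarrow> norm (r x - r y) \<le> c) \<Longrightarrow> dist_of R x y \<le> c"
  unfolding dist_of_def seminorm_of_def
  by (rule cSup_least) (auto simp: diff_R)

lemma dist_of_commute: "dist_of R x y = dist_of R y x"
proof -
  have "dist_of R x y \<le> dist_of R y x" for x y
    by (rule dist_of_le) (metis dist_of_nonneg, metis norm_R_le_dist_of norm_minus_commute)
  then show ?thesis
    by (simp add: antisym)
qed

lemma dist_of_triangle: "dist_of R x z \<le> dist_of R x y + dist_of R y z"
proof (rule dist_of_le)
  fix r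
  assume r: "r \<in> R"
  have "norm (r x - r z) \<le> norm (r x - r y) + norm (r y - r z)"
    using norm_triangle_ineq[of "r x - r y" "r y - r z"] by simp
  then show "norm (r x - r z) \<le> dist_of R x y + dist_of R y z"
    using norm_R_le_dist_of[OF r, of x y] norm_R_le_dist_of[OF r, of y z] by linarith
qed (simp add: dist_of_nonneg)

lemma orbit_pseudo_metric_dist_of:
  assumes G: "subgroup G Aut" and stable: "action_stable fun_action G R"
  shows "orbit_pseudo_metric G (dist_of R)"
proof (rule orbit_pseudo_metric.intro)
  fix g x y
  assume g: "g \<in> G"
  have le: "dist_of R (g x) (g y) \<le> dist_of R x y" if "g \<in> G" for g x y
  proof (rule dist_of_le)
    fix r
    assume r: "r \<in> R"
    obtain h where h: "h \<in> G" "h \<circ> g = id" "g \<circ> h = id"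
      using subgroup_Aut_inverse[OF G \<open>g \<in> G\<close>] .
    \<comment> \<open>Acting on \<open>r\<close> by the inverse \<open>h\<close> of \<open>g\<close>
      gives \<open>r \<circ> g\<close>, which stability keeps in \<open>R\<close>. Hence
      \<open>norm (r (g x) - r (g y))\<close> is among the values bounded by
      \<open>dist_of R x y\<close>.\<close>
    have "fun_action h r \<in> R"
      using stable h(1) r unfolding action_stable_def by blast
    moreover have "fun_action h r = (\<lambda>s. r (g s))"
      using inv_unique_comp[OF h(2,3)] by (simp add: fun_action_def)
    ultimately have "(\<lambda>s. r (g s)) \<in> R" by simp
    from norm_R_le_dist_of[OF this]
    show "norm (r (g x) - r (g y)) \<le> dist_of R x y" .
  qed (rule dist_of_nonneg)
  \<comment> \<open>Applying the inequality to the inverse as well turns it into an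
    equality.\<close>
  obtain h where h: "h \<in> G" "h \<circ> g = id"
    using subgroup_Aut_inverse[OF G g] by metis
  have "dist_of R x y = dist_of R (h (g x)) (h (g y))"
    using h(2) by (metis comp_apply id_apply)
  then show "dist_of R (g x) (g y) = dist_of R x y"
    using le[OF g, of x y] le[OF h(1), of "g x" "g y"] by simp
qed (rule G dist_of_nonneg dist_of_commute dist_of_triangle)+

end

section \<open>Geometric estimates and completeness of the orbit distance on
  \<open>W\<close>\<close>

lemma dist_le_of_geometric_steps:
  fixes d :: "'a \<Rightarrow> 'a \<Rightarrow> real"
  assumes tri: "\<And>x y z. d x z \<le> d x y + d y z"
    and step: "\<And>n. d (y n) (y (Suc n)) \<le> (1/2) ^ n"
    and refl: "\<And>x. d x x = 0"
    and "n \<le> m"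
  shows "d (y n) (y m) \<le> 2 * (1/2) ^ n"
proof -
  \<comment> \<open>The exact sum of the steps from \<open>n\<close> to \<open>m\<close>; keeping
    the negative term lets the induction go through.\<close>
  have "d (y n) (y m) \<le> 2 * (1/2) ^ n - 2 * (1/2) ^ m"
    using \<open>n \<le> m\<close>
  proof (induction m rule: dec_induct)
    case base
    then show ?case by (simp add: refl)
  next
    case (step m)
    then show ?case
      using tri[of "y n" "y (Suc m)" "y m"] assms(2)[of m] by simp
  qed
  moreover have "(0::real) \<le> 2 * (1/2) ^ m" by simp
  ultimately show ?thesis by linarith
qed

theorem theorem3p1:
  fixes smul :: "'k::real_normed_field \<Rightarrow> 'a::banach \<Rightarrow> 'a"
    and G :: "('a \<Rightarrow> 'a) set"
    and R :: "('a \<Rightarrow> 'k) set"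
    and W :: "'a set"
  assumes "banach_space_over smul"
    and "subgroup G Aut"
    and "R \<subseteq> dual_unit_ball smul"
    and "action_stable fun_action G R"
    and "action_stable (\<lambda>g x. g x) G W"
    and "compactin (weak_topology smul) W"
    and "pm_totally_bounded W (orbit_dist (dist_of R) G)"
  shows "compact_space (pm_topology W (orbit_dist (dist_of R) G))"
proof -
  note R = \<open>R \<subseteq> dual_unit_ball smul\<close>
  interpret orbit_pseudo_metric G "dist_of R"
    using orbit_pseudo_metric_dist_of[OF R] assms(2,4) .
  have refl: "dist_of R x x = 0" for x
    using dist_of_le[OF R, of 0 x x] dist_of_nonneg[OF R, of x x] by simp
  show ?thesis
  proof (rule compact_space_pm_topology[OF orbit_dist_commute orbit_dist_triangle assms(7)])
    fix x :: "nat \<Rightarrow> 'a"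
    assume x: "\<And>n. x n \<in> W"
      and fast: "\<And>n. orbit_dist (dist_of R) G (x n) (x (Suc n)) < (1/2) ^ n"
    obtain h where h: "\<And>n. h n \<in> G"
        "\<And>n. dist_of R (h n (x n)) (h (Suc n) (x (Suc n))) < (1/2) ^ n"
      using orbit_dist_sequence_lift[of x "\<lambda>n. (1/2) ^ n", OF fast] by blast
    define y where "y n = h n (x n)" for n
    have yW: "y n \<in> W" for n
      using assms(5) h(1) x unfolding action_stable_def y_def by blast
    have y_close: "dist_of R (y n) (y m) \<le> 2 * (1/2) ^ n" if "n \<le> m" for m n
      using dist_le_of_geometric_steps[of "dist_of R" y, OF triangle _ refl that] h(2)
      by (simp add: y_def less_imp_le)
    \<comment> \<open>The bound is uniform in \<open>r\<close>, so after the weak limit is taken it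
      can be reassembled into a bound on the supremum.\<close>
    have "norm (r (y m) - r (y n)) \<le> 2 * (1/2) ^ n" if "n \<le> m" "r \<in> R" for m n r
      using norm_R_le_dist_of[OF R that(2), of "y m" "y n"] y_close[OF that(1)]
        commute[of "y m" "y n"] by linarith
    moreover have "R \<subseteq> dual_space smul"
      using R by (auto simp: dual_unit_ball_def)
    ultimately obtain l where l: "l \<in> W" "\<And>n r. r \<in> R \<Longrightarrow> norm (r l - r (y n)) \<le> 2 * (1/2) ^ n"
      using weakly_compact_Cauchy_limit[of R smul W y "\<lambda>n. 2 * (1/2) ^ n"] assms(6) yW
      by blast
    have "orbit_dist (dist_of R) G l (x n) \<le> 2 * (1/2) ^ n" for n
    proof -
      \<comment> \<open>Since \<open>y n\<close> lies in the orbit of \<open>x n\<close>, the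
        element \<open>h n\<close> competes in the infimum, so a limit of the lifted sequence is
        also one for \<open>x\<close>.\<close>
      have "orbit_dist (dist_of R) G l (x n) \<le> dist_of R l (y n)"
        unfolding y_def by (rule orbit_dist_le[OF h(1)])
      also have "\<dots> \<le> 2 * (1/2) ^ n"
        by (rule dist_of_le[OF R _ l(2)]) simp_all
      finally show ?thesis .
    qed
    then show "\<exists>l\<in>W. \<forall>n. orbit_dist (dist_of R) G l (x n) \<le> 2 * (1/2) ^ n"
      using l(1) by blast
  qed
qed

end
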